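(* Let $(\mathcal{S},\mathcal{A},p,r)$ be a finite Markov decision process with discount factor $\gamma\in[0,1)$, and let $Q^*$ denote its optimal action-value function, i.e. the unique solution of the Bellman optimality equation $Q^*(s,a)=\mathbb{E}[r(s,a)]+\gamma\,\mathbb{E}_{s'\sim p(\cdot\mid s,a)}\big[\max_{a'}Q^*(s',a')\big]$. Let $g:\mathbb{R}^3\to\mathbb{R}$ be either of the following target mappings: (i) $g(x,y,z)=$ the mean of the two smallest of $x,y,z$; or (ii) $g(x,y,z)=$ the median of $x,y,z$. Clipped Triple Q-learning maintains three lookup tables $Q^A_t,Q^B_t,Q^C_t:\mathcal{S}\times\mathcal{A}\to\mathbb{R}$ (arbitrary initial tables $Q^A_0,Q^B_0,Q^C_0$). At each time step $t=0,1,2,\dots$, a state-action pair $(s_t,a_t)$ is visited, a reward $r_t$ (a sample of $r(s_t,a_t)$) and next state $s_{t+1}\sim p(\cdot\mid s_t,a_t)$ are observed, and with $a^*=\arg\max_a Q^A_t(s_{t+1},a)$ and $$y_t=r_t+\gamma\, g\big(Q^A_t(s_{t+1},a^* ),\,Q^B_t(s_{t+1},a^* ),\,Q^C_t(s_{t+1},a^* )\big),$$ every table $X\in\{A,B,C\}$ is updated by $$Q^X_{t+1}(s,a)=Q^X_t(s,a)+\alpha_t(s,a)\big(y_t-Q^X_t(s,a)\big)\quad\text{if }(s,a)=(s_t,a_t),$$ and $Q^X_{t+1}(s,a)=Q^X_t(s,a)$ otherwise. Assume: (1) each state-action pair is visited infinitely often; (2) the learning rates satisfy $\alpha_t(s,a)\in[0,1]$,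 $\sum_t\alpha_t(s,a)=\infty$ and $\sum_t\alpha_t(s,a)^2<\infty$ with probability 1, and $\alpha_t(s,a)=0$ for all $(s,a)\neq(s_t,a_t)$; (3) $\mathrm{Var}[r(s,a)]<\infty$ for all $(s,a)$. Then, with probability 1, each of $Q^A_t$, $Q^B_t$, $Q^C_t$ converges to $Q^*$ as $t\to\infty$.
   Context: Rewards $r(s,a)$ are random variables with finite variance; $p(\cdot\mid s,a)$ is the transition distribution. The learning rates $\alpha_t(s,a)$ may be random but are determined by the history $\{Q^A_0,Q^B_0,Q^C_0,s_0,a_0,\alpha_0,r_0,s_1,\dots,s_t,a_t\}$ up to time $t$. Ties in $\arg\max$ are broken by an arbitrary fixed rule. *)

theory Defs
  imports "HOL-Probability.Probability"
begin

definition mean_two_smallest :: "real \<Rightarrow> real \<Rightarrow> real \<Rightarrow> real" where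
  "mean_two_smallest x y z = (let l = sort [x, y, z] in (l ! 0 + l ! 1) / 2)"

definition median3 :: "real \<Rightarrow> real \<Rightarrow> real \<Rightarrow> real" where
  "median3 x y z = sort [x, y, z] ! 1"

definition bellman_optimal ::
  "('s::finite \<Rightarrow> 'a::finite \<Rightarrow> 's pmf) \<Rightarrow> ('s \<Rightarrow> 'a \<Rightarrow> real measure) \<Rightarrow> real
    \<Rightarrow> ('s \<Rightarrow> 'a \<Rightarrow> real) \<Rightarrow> bool" where
  "bellman_optimal p R \<gamma> Q \<longleftrightarrow>
     (\<forall>x b. Q x b = (\<integral>z. z \<partial>R x b)
                     + \<gamma> * measure_pmf.expectation (p x b) (\<lambda>x'. Max (range (Q x'))))"

text \<open>Clipped Triple Q-learning, along one trajectory.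
  Arguments: target mapping g, discount gamma, tie-breaking argmax rule sel,
  initial tables (QA0,QB0,QC0), visited states S, actions A, rewards Rw,
  learning rates alpha.  Returns the triple of tables at time t.\<close>

primrec ctq ::
  "(real \<Rightarrow> real \<Rightarrow> real \<Rightarrow> real) \<Rightarrow> real \<Rightarrow> (('a \<Rightarrow> real) \<Rightarrow> 'a)
   \<Rightarrow> ('s \<Rightarrow> 'a \<Rightarrow> real) \<times> ('s \<Rightarrow> 'a \<Rightarrow> real) \<times> ('s \<Rightarrow> 'a \<Rightarrow> real)
   \<Rightarrow> (nat \<Rightarrow> 's) \<Rightarrow> (nat \<Rightarrow> 'a) \<Rightarrow> (nat \<Rightarrow> real) \<Rightarrow> (nat \<Rightarrow> 's \<Rightarrow> 'a \<Rightarrow> real) \<Rightarrow> nat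
   \<Rightarrow> ('s \<Rightarrow> 'a \<Rightarrow> real) \<times> ('s \<Rightarrow> 'a \<Rightarrow> real) \<times> ('s \<Rightarrow> 'a \<Rightarrow> real)" where
  "ctq g \<gamma> sel Q0 S A Rw \<alpha> 0 = Q0"
| "ctq g \<gamma> sel Q0 S A Rw \<alpha> (Suc t) =
     (let (QA, QB, QC) = ctq g \<gamma> sel Q0 S A Rw \<alpha> t;
          s' = S (Suc t);
          a' = sel (QA s');
          y = Rw t + \<gamma> * g (QA s' a') (QB s' a') (QC s' a');
          upd = (\<lambda>Q x b. if (x, b) = (S t, A t) then Q x b + \<alpha> t x b * (y - Q x b) else Q x b)
      in (upd QA, upd QB, upd QC))"

end

theory Submission
  imports Defs
begin

text \<open>
  The tie-breaking rule \<open>sel\<close> need not be measurable, so the tables are never treated as random variables.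
  The differences \<open>Q\<^sup>B - Q\<^sup>A\<close> and \<open>Q\<^sup>C - Q\<^sup>A\<close> are multiplied by \<open>1 - \<alpha>\<close> at every update and hence
  vanish, and \<open>g\<close> moves its first argument by at most the distance to the other two. The target is
  therefore \<open>r + \<gamma> max Q\<^sup>A(s', \<cdot>)\<close> up to a vanishing error. Comparing it with \<open>r + \<gamma> max Q\<^sup>*(s', \<cdot>)\<close>
  costs at most \<open>\<gamma> \<parallel>Q\<^sup>A - Q\<^sup>*\<parallel>\<close> on every trajectory, and the remaining noise
  \<open>r + \<gamma> max Q\<^sup>*(s', \<cdot>) - Q\<^sup>*(s, a)\<close> is a martingale difference with bounded conditional variance that no
  longer involves the iterates. Its \<open>\<alpha>\<close>-weighted sums converge almost surely. Subtracting from
  \<open>Q\<^sup>A - Q\<^sup>*\<close> the deviation of these sums from their limit leaves a noiseless asynchronous contraction.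
\<close>

section \<open>Asynchronous contractions\<close>

text \<open>The excess \<open>u t - c\<close> is multiplied by at most
  \<open>1 - a t \<le> exp (- a t)\<close> in each step. These factors accumulate to the exponential
  of minus a partial sum of \<open>a\<close>, which divergence of the sums sends to 0.\<close>

lemma relaxation_eventually_le:
  fixes u a :: "nat \<Rightarrow> real"
  assumes step: "\<And>t. t \<ge> T \<Longrightarrow> u (Suc t) \<le> (1 - a t) * u t + a t * c"
    and a: "\<And>t. a t \<le> 1"
    and div: "filterlim (\<lambda>n. \<Sum>t<n. a t) at_top sequentially"
    and e: "e > 0"
  shows "\<forall>\<^sub>F t in sequentially. u t \<le> c + e"
proof -
  define s where "s t = (\<Sum>i<t. a i)" for t
  \<comment> \<open>Truncation at 0 keeps the bound nonnegative, so that \<open>1 - a t\<close> may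
    be replaced by \<open>exp (- a t)\<close> in front of it even when \<open>u\<close> starts below
    \<open>c\<close>.\<close>
  define K where "K = max 0 (u T - c)"
  have bound: "u t - c \<le> exp (s T - s t) * K" if "t \<ge> T" for t
    using that
  proof (induction t rule: dec_induct)
    case base
    show ?case by (simp add: K_def)
  next
    case (step t)
    have "u (Suc t) - c \<le> (1 - a t) * (u t - c)"
      using assms(1)[OF step(1)] by (simp add: algebra_simps)
    also have "\<dots> \<le> (1 - a t) * (exp (s T - s t) * K)"
      using step.IH a[of t] by (intro mult_left_mono) auto
    also have "\<dots> \<le> exp (- a t) * (exp (s T - s t) * K)"
      using exp_ge_add_one_self[of "- a t"] by (intro mult_right_mono) (auto simp: K_def)
    also have "\<dots> = exp (s T - s (Suc t)) * K"
      by (simp add: s_def exp_diff exp_minus exp_add field_simps)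
    finally show ?case .
  qed
  have "filterlim (\<lambda>t. s t - s T) at_top sequentially"
    using filterlim_tendsto_add_at_top[OF tendsto_const[of "- s T"] div]
    by (simp add: s_def algebra_simps)
  then have "filterlim (\<lambda>t. s T - s t) at_bot sequentially"
    by (simp add: filterlim_uminus_at_bot)
  then have "(\<lambda>t. exp (s T - s t)) \<longlonglongrightarrow> 0"
    by (rule filterlim_compose[OF exp_at_bot])
  then have "(\<lambda>t. exp (s T - s t) * K) \<longlonglongrightarrow> 0 * K"
    by (intro tendsto_mult tendsto_const)
  then have "\<forall>\<^sub>F t in sequentially. exp (s T - s t) * K < e"
    using e by (intro order_tendstoD) auto
  then show ?thesis
    using eventually_ge_at_top[of T]
    by eventually_elim (use bound in fastforce)
qed

text \<open>The hypothesis on \<open>h\<close> says \<open>\<bar>h t i\<bar> \<le> \<gamma> * \<parallel>X t\<parallel> + d t\<close> in the sup norm, with the norm replaced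
  by an arbitrary bound.\<close>

lemma asynchronous_contraction_tendsto_0:
  fixes X a h :: "nat \<Rightarrow> 'i::finite \<Rightarrow> real"
  assumes \<gamma>: "0 \<le> \<gamma>" "\<gamma> < 1"
    and step: "\<And>t i. X (Suc t) i = (1 - a t i) * X t i + a t i * h t i"
    and a: "\<And>t i. 0 \<le> a t i" "\<And>t i. a t i \<le> 1"
    and div: "\<And>i. filterlim (\<lambda>n. \<Sum>t<n. a t i) at_top sequentially"
    and h: "\<And>t i C. (\<And>j. \<bar>X t j\<bar> \<le> C) \<Longrightarrow> \<bar>h t i\<bar> \<le> \<gamma> * C + d t"
    and d: "d \<longlonglongrightarrow> 0"
  shows "(\<lambda>t. X t i) \<longlonglongrightarrow> 0"
proof -
  have abs_step: "\<bar>X (Suc t) i\<bar> \<le> (1 - a t i) * \<bar>X t i\<bar> + a t i * c" if "\<bar>h t i\<bar> \<le> c" for t i c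
  proof -
    have "\<bar>X (Suc t) i\<bar> \<le> \<bar>(1 - a t i) * X t i\<bar> + \<bar>a t i * h t i\<bar>"
      unfolding step by (rule abs_triangle_ineq)
    also have "\<dots> = (1 - a t i) * \<bar>X t i\<bar> + a t i * \<bar>h t i\<bar>"
      using a[of t i] by (simp add: abs_mult)
    also have "\<dots> \<le> (1 - a t i) * \<bar>X t i\<bar> + a t i * c"
      using that a[of t i] by (intro add_left_mono mult_left_mono) auto
    finally show ?thesis .
  qed
  obtain d0 where d0: "\<And>t. \<bar>d t\<bar> \<le> d0"
    using convergent_imp_Bseq[OF convergentI[OF d]] by (auto simp: Bseq_def)
  \<comment> \<open>The first entry dominates the initial sup norm. The second gives
    \<open>d0 \<le> (1 - \<gamma>) * B0\<close>, hence \<open>\<gamma> * B0 + d0 \<le> B0\<close>,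
    so the ball of radius \<open>B0\<close> is never left.\<close>
  define B0 where "B0 = max (\<Sum>j\<in>UNIV. \<bar>X 0 j\<bar>) (d0 / (1 - \<gamma>))"
  have B0: "\<bar>X t j\<bar> \<le> B0" for t j
  proof (induction t arbitrary: j)
    case 0
    have "\<bar>X 0 j\<bar> \<le> (\<Sum>j\<in>UNIV. \<bar>X 0 j\<bar>)"
      by (rule member_le_sum) auto
    then show ?case by (simp add: B0_def)
  next
    case (Suc t)
    have "d0 \<le> (1 - \<gamma>) * B0"
      using \<gamma> by (simp add: B0_def max_def field_simps)
    then have "\<bar>h t j\<bar> \<le> B0"
      using h[OF Suc, of j] d0[of t] by (auto simp: algebra_simps)
    from abs_step[OF this] have "\<bar>X (Suc t) j\<bar> \<le> (1 - a t j) * \<bar>X t j\<bar> + a t j * B0" .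
    also have "\<dots> \<le> (1 - a t j) * B0 + a t j * B0"
      using Suc[of j] a(2)[of t j] by (intro add_right_mono mult_left_mono) auto
    finally show ?case by (simp add: algebra_simps)
  qed
  \<comment> \<open>The infimum \<open>L\<close> of these eventual bounds plays the role of the
    limit superior of the sup norm. Every bound \<open>B\<close> improves to
    \<open>\<gamma> * B + e\<close>: half of \<open>e\<close> absorbs \<open>d\<close>, the other
    half is the slack of the relaxation. This forces \<open>L \<le> \<gamma> * L\<close>, so
    \<open>L \<le> 0\<close>.\<close>
  define EB where "EB = {B. \<forall>\<^sub>F t in sequentially. \<forall>j. \<bar>X t j\<bar> \<le> B}"
  have improve: "\<gamma> * B + e \<in> EB" if "B \<in> EB" "e > 0" for B e
  proof -
    have "\<forall>\<^sub>F t in sequentially. d t < e / 2"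
      using d that(2) by (intro order_tendstoD) auto
    with that(1) have "\<forall>\<^sub>F t in sequentially. (\<forall>j. \<bar>X t j\<bar> \<le> B) \<and> d t < e / 2"
      by (auto simp: EB_def eventually_conj_iff)
    then obtain T where T: "\<And>t j. t \<ge> T \<Longrightarrow> \<bar>X t j\<bar> \<le> B" "\<And>t. t \<ge> T \<Longrightarrow> d t < e / 2"
      unfolding eventually_sequentially by blast
    have "\<forall>\<^sub>F t in sequentially. \<bar>X t j\<bar> \<le> (\<gamma> * B + e / 2) + e / 2" for j
    proof (rule relaxation_eventually_le)
      fix t assume "t \<ge> T"
      with h[OF T(1)[OF this], of j] T(2)[OF this] show
        "\<bar>X (Suc t) j\<bar> \<le> (1 - a t j) * \<bar>X t j\<bar> + a t j * (\<gamma> * B + e / 2)"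
        by (intro abs_step) auto
    qed (use a div that in auto)
    then show ?thesis
      by (auto simp: EB_def add.commute intro: eventually_all_finite)
  qed
  define L where "L = Inf EB"
  have nonneg: "0 \<le> B" if B: "B \<in> EB" for B
  proof -
    obtain t where "\<forall>j. \<bar>X t j\<bar> \<le> B"
      using eventually_happens'[OF _ B[unfolded EB_def mem_Collect_eq]] by auto
    then show ?thesis
      using abs_ge_zero order_trans by blast
  qed
  have bdd: "bdd_below EB" using nonneg by (rule bdd_belowI)
  have ne: "EB \<noteq> {}" using B0 by (auto simp: EB_def intro!: exI[of _ B0])
  have "L \<le> \<gamma> * L"
  proof (rule field_le_epsilon)
    fix e :: real assume "e > 0"
    then obtain B where B: "B \<in> EB" "B < L + e / 2"
      using cInf_lessD[OF ne, of "L + e / 2"] by (auto simp: L_def)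
    have "L \<le> \<gamma> * B + e / 2"
      unfolding L_def using improve[OF B(1)] \<open>e > 0\<close> bdd by (intro cInf_lower) auto
    also have "\<gamma> * B \<le> \<gamma> * (L + e / 2)"
      using B \<gamma> by (intro mult_left_mono) auto
    also have "\<gamma> * (L + e / 2) \<le> \<gamma> * L + e / 2"
      using \<gamma> \<open>e > 0\<close> by (simp add: algebra_simps)
    finally show "L \<le> \<gamma> * L + e" by simp
  qed
  then have "(1 - \<gamma>) * L \<le> 0" by (simp add: algebra_simps)
  then have "L \<le> 0"
    using \<gamma> by (simp add: mult_le_0_iff)
  show ?thesis
  proof (rule LIMSEQ_I)
    fix r :: real assume "r > 0"
    then obtain B where "B \<in> EB" "B < r"
      using cInf_lessD[OF ne, of r] \<open>L \<le> 0\<close> by (auto simp: L_def)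
    moreover from this obtain T where "\<And>t j. t \<ge> T \<Longrightarrow> \<bar>X t j\<bar> \<le> B"
      unfolding EB_def eventually_sequentially by blast
    ultimately have "\<forall>n\<ge>T. norm (X n i - 0) < r"
      by (auto intro: order_le_less_trans)
    then show "\<exists>no. \<forall>n\<ge>no. norm (X n i - 0) < r" ..
  qed
qed

section \<open>Clipped Triple Q-learning along one trajectory\<close>

text \<open>An order statistic of three numbers in an interval around \<open>x\<close> stays in that
  interval, and so does an average of two of them. This stability is what \<open>ctq_tendsto\<close>
  asks of the target mapping.\<close>

lemma median3_bound:
  assumes "\<bar>y - x\<bar> \<le> e" "\<bar>z - x\<bar> \<le> e"
  shows "\<bar>median3 x y z - x\<bar> \<le> e"
  using assms by (auto simp: median3_def)

lemma mean_two_smallest_bound: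
  assumes "\<bar>y - x\<bar> \<le> e" "\<bar>z - x\<bar> \<le> e"
  shows "\<bar>mean_two_smallest x y z - x\<bar> \<le> e"
  using assms by (auto simp: mean_two_smallest_def abs_if field_simps split: if_splits)

text \<open>Each maximum is attained, and evaluating the other function at the maximizer bounds the
  difference in both directions. This nonexpansiveness makes the discounted target a
  \<open>\<gamma>\<close>-contraction.\<close>

lemma Max_range_diff_le:
  fixes f g :: "'a::finite \<Rightarrow> real"
  assumes "\<And>b. \<bar>f b - g b\<bar> \<le> e"
  shows "\<bar>Max (range f) - Max (range g)\<bar> \<le> e"
proof -
  have "Max (range f) \<in> range f" "Max (range g) \<in> range g" by (auto intro!: Max_in)
  then obtain b b' where b: "Max (range f) = f b" "Max (range g) = g b'" by blast
  have "g b \<le> Max (range g)" "f b' \<le> Max (range f)" by (auto intro!: Max_ge)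
  with b assms[of b] assms[of b'] show ?thesis by linarith
qed


text \<open>The deterministic core: randomness is reduced to the hypothesis \<open>noise\<close> on
  a single trajectory. The Bellman equation enters later, when the centred summands of
  \<open>noise\<close> are shown to have mean zero.\<close>

lemma ctq_tendsto:
  fixes S :: "nat \<Rightarrow> 's::finite" and A :: "nat \<Rightarrow> 'a::finite" and Rw :: "nat \<Rightarrow> real"
    and \<alpha> :: "nat \<Rightarrow> 's \<Rightarrow> 'a \<Rightarrow> real" and Qstar QA0 QB0 QC0 :: "'s \<Rightarrow> 'a \<Rightarrow> real"
  assumes gamma: "0 \<le> \<gamma>" "\<gamma> < 1"
    and g: "\<And>x y z e. \<bar>y - x\<bar> \<le> e \<Longrightarrow> \<bar>z - x\<bar> \<le> e \<Longrightarrow> \<bar>g x y z - x\<bar> \<le> e"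
    and sel: "\<And>f. f (sel f) = Max (range f)"
    and \<alpha>: "\<And>t x b. 0 \<le> \<alpha> t x b" "\<And>t x b. \<alpha> t x b \<le> 1"
      "\<And>t x b. (x, b) \<noteq> (S t, A t) \<Longrightarrow> \<alpha> t x b = 0"
      "\<And>x b. filterlim (\<lambda>n. \<Sum>t<n. \<alpha> t x b) at_top sequentially"
    and noise: "\<And>x b. convergent (\<lambda>n. \<Sum>t<n. \<alpha> t x b *
      (if S t = x \<and> A t = b then Rw t + \<gamma> * Max (range (Qstar (S (Suc t)))) - Qstar x b else 0))"
  defines "Q \<equiv> ctq g \<gamma> sel (QA0, QB0, QC0) S A Rw \<alpha>"
  shows "(\<lambda>t. fst (Q t) x b) \<longlonglongrightarrow> Qstar x b"
    and "(\<lambda>t. fst (snd (Q t)) x b) \<longlonglongrightarrow> Qstar x b"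
    and "(\<lambda>t. snd (snd (Q t)) x b) \<longlonglongrightarrow> Qstar x b"
proof -
  define QA where "QA t = fst (Q t)" for t
  define QB where "QB t = fst (snd (Q t))" for t
  define QC where "QC t = snd (snd (Q t))" for t
  define a' where "a' t = sel (QA t (S (Suc t)))" for t
  define G where "G t = g (QA t (S (Suc t)) (a' t)) (QB t (S (Suc t)) (a' t)) (QC t (S (Suc t)) (a' t))" for t
  define y where "y t = Rw t + \<gamma> * G t" for t
  \<comment> \<open>Since \<open>\<alpha>\<close> vanishes off the visited pair, the update formula
    holds at every pair without a case distinction.\<close>
  have "QA (Suc t) x b = QA t x b + \<alpha> t x b * (y t - QA t x b) \<and>
      QB (Suc t) x b = QB t x b + \<alpha> t x b * (y t - QB t x b) \<and>
      QC (Suc t) x b = QC t x b + \<alpha> t x b * (y t - QC t x b)" for t x b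
    using \<alpha>(3)[of x b t]
    by (cases "(x, b) = (S t, A t)")
      (auto simp: QA_def QB_def QC_def Q_def y_def G_def a'_def Let_def split: prod.splits)
  then have QA_Suc: "QA (Suc t) x b = QA t x b + \<alpha> t x b * (y t - QA t x b)"
    and QB_Suc: "QB (Suc t) x b = QB t x b + \<alpha> t x b * (y t - QB t x b)"
    and QC_Suc: "QC (Suc t) x b = QC t x b + \<alpha> t x b * (y t - QC t x b)" for t x b
    by blast+
  \<comment> \<open>The common target \<open>y t\<close> cancels in the difference of two tables,
    leaving pure decay: the contraction lemma with factor 0 and no forcing term.\<close>
  have "(\<lambda>t. (\<lambda>(x, b). QB t x b - QA t x b) (x, b)) \<longlonglongrightarrow> 0" for x b
    by (rule asynchronous_contraction_tendsto_0[where \<gamma> = 0 and a = "\<lambda>t (x, b). \<alpha> t x b"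
          and h = "\<lambda>_ _. 0" and d = "\<lambda>_. 0"])
      (use \<alpha> in \<open>auto simp: QA_Suc QB_Suc algebra_simps split: prod.splits\<close>)
  then have AB: "(\<lambda>t. QB t x b - QA t x b) \<longlonglongrightarrow> 0" for x b by simp
  have "(\<lambda>t. (\<lambda>(x, b). QC t x b - QA t x b) (x, b)) \<longlonglongrightarrow> 0" for x b
    by (rule asynchronous_contraction_tendsto_0[where \<gamma> = 0 and a = "\<lambda>t (x, b). \<alpha> t x b"
          and h = "\<lambda>_ _. 0" and d = "\<lambda>_. 0"])
      (use \<alpha> in \<open>auto simp: QA_Suc QC_Suc algebra_simps split: prod.splits\<close>)
  then have AC: "(\<lambda>t. QC t x b - QA t x b) \<longlonglongrightarrow> 0" for x b by simp

  define V where "V s = Max (range (Qstar s))" for s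
  define w where "w t x b = (if S t = x \<and> A t = b then Rw t + \<gamma> * V (S (Suc t)) - Qstar x b else 0)" for t x b
  define m where "m n x b = (\<Sum>t<n. \<alpha> t x b * w t x b)" for n x b
  \<comment> \<open>Subtracting the limit leaves the increments unchanged, so \<open>r\<close> still
    accumulates the noise, but now it tends to 0.\<close>
  define r where "r t x b = m t x b - lim (\<lambda>n. m n x b)" for t x b
  have "(\<lambda>t. m t x b) \<longlonglongrightarrow> lim (\<lambda>n. m n x b)" for x b
    using noise[of x b] unfolding m_def w_def V_def convergent_LIMSEQ_iff .
  then have r: "(\<lambda>t. r t x b) \<longlonglongrightarrow> 0" for x b
    unfolding r_def by (rule LIM_zero)
  have r_Suc: "r (Suc t) x b = r t x b + \<alpha> t x b * w t x b" for t x b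
    by (simp add: r_def m_def)
  \<comment> \<open>Subtracting \<open>r\<close> cancels \<open>w\<close> from the recursion. The
    term \<open>- r t x b\<close> in \<open>h\<close> remains because the update relaxes
    \<open>QA - Qstar\<close>, which is \<open>X + r\<close> and not \<open>X\<close>.\<close>
  define X where "X t = (\<lambda>(x, b). QA t x b - Qstar x b - r t x b)" for t
  define h where "h t = (\<lambda>(x, b). (if (x, b) = (S t, A t) then \<gamma> * (G t - V (S (Suc t))) else 0) - r t x b)" for t
  define e where "e t = (\<Sum>(x, b)\<in>UNIV. \<bar>QB t x b - QA t x b\<bar> + \<bar>QC t x b - QA t x b\<bar>)" for t
  define N where "N t = (\<Sum>(x, b)\<in>UNIV. \<bar>r t x b\<bar>)" for t
  have e_bound: "\<bar>QB t x b - QA t x b\<bar> + \<bar>QC t x b - QA t x b\<bar> \<le> e t" for t x b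
    using member_le_sum[of "(x, b)" UNIV "\<lambda>(x, b). \<bar>QB t x b - QA t x b\<bar> + \<bar>QC t x b - QA t x b\<bar>"]
    by (auto simp: e_def)
  have N_bound: "\<bar>r t x b\<bar> \<le> N t" for t x b
    using member_le_sum[of "(x, b)" UNIV "\<lambda>(x, b). \<bar>r t x b\<bar>"] by (auto simp: N_def)
  have e0: "e \<longlonglongrightarrow> 0"
    unfolding e_def[abs_def] case_prod_unfold
    by (intro tendsto_null_sum tendsto_add_zero tendsto_rabs_zero AB AC)
  have N0: "N \<longlonglongrightarrow> 0"
    unfolding N_def[abs_def] case_prod_unfold
    by (intro tendsto_null_sum tendsto_rabs_zero r)
  have X0: "(\<lambda>t. X t (x, b)) \<longlonglongrightarrow> 0" for x b
  proof (rule asynchronous_contraction_tendsto_0[OF gamma])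
    fix t i
    show "X (Suc t) i = (1 - (\<lambda>(x, b). \<alpha> t x b) i) * X t i + (\<lambda>(x, b). \<alpha> t x b) i * h t i"
    proof (cases i)
      case (Pair x b)
      show ?thesis
        using \<alpha>(3)[of x b t]
        by (cases "(x, b) = (S t, A t)")
          (auto simp: Pair X_def h_def QA_Suc r_Suc w_def y_def algebra_simps)
    qed
    \<comment> \<open>The chain is \<open>G t\<close>, the maximum of \<open>QA t\<close> at the
      next state, then \<open>V\<close>. The first comparison costs \<open>e t\<close>, the second
      \<open>C + N t\<close>, both discounted; the undiscounted \<open>N t\<close> comes from the
      term \<open>- r\<close> in \<open>h\<close>.\<close>
    fix C assume X: "\<And>j. \<bar>X t j\<bar> \<le> C"
    have \<Delta>: "\<bar>QA t x b - Qstar x b\<bar> \<le> C + N t" for x b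
      using X[of "(x, b)"] N_bound[of t x b] by (simp add: X_def)
    let ?s = "S (Suc t)"
    have "\<bar>G t - QA t ?s (a' t)\<bar> \<le> e t"
      unfolding G_def using e_bound[of t ?s "a' t"] by (intro g) linarith+
    moreover have "QA t ?s (a' t) = Max (range (QA t ?s))"
      unfolding a'_def by (rule sel)
    moreover have "\<bar>Max (range (QA t ?s)) - V ?s\<bar> \<le> C + N t"
      unfolding V_def by (intro Max_range_diff_le \<Delta>)
    ultimately have "\<bar>G t - V ?s\<bar> \<le> C + N t + e t" by linarith
    then have "\<bar>\<gamma> * (G t - V ?s)\<bar> \<le> \<gamma> * (C + N t + e t)"
      using gamma by (simp add: abs_mult mult_left_mono)
    moreover obtain x b where i: "i = (x, b)" by (cases i)
    have "\<bar>h t i\<bar> \<le> \<bar>\<gamma> * (G t - V ?s)\<bar> + \<bar>r t x b\<bar>"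
      using abs_triangle_ineq4[of "\<gamma> * (G t - V ?s)" "r t x b"] by (auto simp: h_def i)
    ultimately have "\<bar>h t i\<bar> \<le> \<gamma> * (C + N t + e t) + N t"
      using N_bound[of t x b] by linarith
    then show "\<bar>h t i\<bar> \<le> \<gamma> * C + (\<gamma> * (N t + e t) + N t)"
      by (simp add: algebra_simps)
  next
    have "(\<lambda>t. \<gamma> * (N t + e t) + N t) \<longlonglongrightarrow> \<gamma> * (0 + 0) + 0"
      by (intro tendsto_intros e0 N0)
    then show "(\<lambda>t. \<gamma> * (N t + e t) + N t) \<longlonglongrightarrow> 0" by simp
  qed (use \<alpha> in auto)
  have "(\<lambda>t. X t (x, b) + r t x b + Qstar x b) \<longlonglongrightarrow> 0 + 0 + Qstar x b"
    by (intro tendsto_add X0 r tendsto_const)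
  then have A: "(\<lambda>t. QA t x b) \<longlonglongrightarrow> Qstar x b"
    by (simp add: X_def)
  show "(\<lambda>t. fst (Q t) x b) \<longlonglongrightarrow> Qstar x b"
    using A by (simp add: QA_def)
  show "(\<lambda>t. fst (snd (Q t)) x b) \<longlonglongrightarrow> Qstar x b"
    using tendsto_add[OF AB[of x b] A] by (simp add: QB_def)
  show "(\<lambda>t. snd (snd (Q t)) x b) \<longlonglongrightarrow> Qstar x b"
    using tendsto_add[OF AC[of x b] A] by (simp add: QC_def)
qed

section \<open>Convergence of martingale transforms\<close>

text \<open>The indices are shifted: \<open>\<xi> t\<close> is revealed at time
  \<open>t + 1\<close>, so a coefficient known at time \<open>t\<close> is predictable for it. The
  constant \<open>v\<close> bounds the variance conditionally, which is what random coefficients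
  require.\<close>

locale square_integrable_martingale_differences = prob_space M
  for M :: "'w measure" +
  fixes F :: "nat \<Rightarrow> 'w measure" and \<xi> :: "nat \<Rightarrow> 'w \<Rightarrow> real" and v :: real
  assumes subalg: "\<And>t. subalgebra M (F t)"
    and F_Suc: "\<And>t. sets (F t) \<subseteq> sets (F (Suc t))"
    and adapted: "\<And>t. \<xi> t \<in> borel_measurable (F (Suc t))"
    and square_integrable: "\<And>t. integrable M (\<lambda>\<omega>. (\<xi> t \<omega>)\<^sup>2)"
    and cond_mean: "\<And>t. AE \<omega> in M. real_cond_exp M (F t) (\<xi> t) \<omega> = 0"
    and cond_variance: "\<And>t. AE \<omega> in M. real_cond_exp M (F t) (\<lambda>\<omega>. (\<xi> t \<omega>)\<^sup>2) \<omega> \<le> v"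
begin

lemma measurable_F_mono:
  assumes "f \<in> F s \<rightarrow>\<^sub>M N" "s \<le> t"
  shows "f \<in> F t \<rightarrow>\<^sub>M N"
proof -
  have "sets (F s) \<subseteq> sets (F t)"
    using F_Suc assms(2) by (rule lift_Suc_mono_le)
  moreover have "space (F s) = space (F t)"
    using subalg by (metis subalgebra_def)
  ultimately show ?thesis
    using assms(1) by (auto intro: measurable_from_subalg simp: subalgebra_def)
qed

lemma measurable_F_imp_M: "f \<in> F t \<rightarrow>\<^sub>M N \<Longrightarrow> f \<in> M \<rightarrow>\<^sub>M N"
  using measurable_from_subalg[OF subalg] .

lemma transform_measurable:
  assumes "\<And>t. c t \<in> borel_measurable (F t)"
  shows "(\<lambda>\<omega>. \<Sum>t<n. c t \<omega> * \<xi> t \<omega>) \<in> borel_measurable (F n)"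
proof (intro borel_measurable_sum borel_measurable_times)
  fix t assume "t \<in> {..<n}"
  then show "c t \<in> borel_measurable (F n)" "\<xi> t \<in> borel_measurable (F n)"
    using measurable_F_mono[OF assms] measurable_F_mono[OF adapted] by auto
qed

lemma integrable_mult_of_squares:
  fixes f g :: "'w \<Rightarrow> real"
  assumes "f \<in> borel_measurable M" "g \<in> borel_measurable M"
    and "integrable M (\<lambda>\<omega>. (f \<omega>)\<^sup>2)" "integrable M (\<lambda>\<omega>. (g \<omega>)\<^sup>2)"
  shows "integrable M (\<lambda>\<omega>. f \<omega> * g \<omega>)"
proof (rule Bochner_Integration.integrable_bound)
  show "integrable M (\<lambda>\<omega>. (f \<omega>)\<^sup>2 + (g \<omega>)\<^sup>2)"
    using assms by auto
  have "\<bar>x * y\<bar> \<le> x\<^sup>2 + y\<^sup>2" for x y :: real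
    using sum_squares_bound[of "\<bar>x\<bar>" "\<bar>y\<bar>"] mult_nonneg_nonneg[of "\<bar>x\<bar>" "\<bar>y\<bar>"]
    unfolding abs_mult power2_abs by linarith
  then show "AE \<omega> in M. norm (f \<omega> * g \<omega>) \<le> norm ((f \<omega>)\<^sup>2 + (g \<omega>)\<^sup>2)"
    by simp
qed (use assms in simp)

text \<open>Orthogonality of martingale differences: when the square is expanded, the cross term has
  a factor known at time \<open>n\<close> and vanishes by the conditional mean. The diagonal term is
  controlled by the conditional variance.\<close>

lemma transform_second_moment:
  assumes c: "\<And>t. c t \<in> borel_measurable (F t)" "\<And>t \<omega>. \<bar>c t \<omega>\<bar> \<le> C"
  shows "integrable M (\<lambda>\<omega>. (\<Sum>t<n. c t \<omega> * \<xi> t \<omega>)\<^sup>2)"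
    and "expectation (\<lambda>\<omega>. (\<Sum>t<n. c t \<omega> * \<xi> t \<omega>)\<^sup>2) \<le> v * expectation (\<lambda>\<omega>. \<Sum>t<n. (c t \<omega>)\<^sup>2)"
proof -
  have c_M: "c t \<in> borel_measurable M" and \<xi>_M: "\<xi> t \<in> borel_measurable M" for t
    using measurable_F_imp_M c(1) adapted by blast+
  have "C \<ge> 0" using c(2) abs_ge_zero order_trans by blast
  then have c2: "(c t \<omega>)\<^sup>2 \<le> C\<^sup>2" for t \<omega>
    using power_mono[OF c(2)[of t \<omega>] abs_ge_zero, of 2] by simp
  have c2_int: "integrable M (\<lambda>\<omega>. (c t \<omega>)\<^sup>2)" for t
    by (rule integrable_const_bound[of _ "C\<^sup>2"]) (use c_M c2 in auto)
  have d2_int: "integrable M (\<lambda>\<omega>. (c t \<omega>)\<^sup>2 * (\<xi> t \<omega>)\<^sup>2)" for t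
  proof (rule Bochner_Integration.integrable_bound)
    show "integrable M (\<lambda>\<omega>. C\<^sup>2 * (\<xi> t \<omega>)\<^sup>2)"
      using square_integrable by simp
  qed (use c_M \<xi>_M c2 in \<open>auto intro!: mult_right_mono\<close>)
  have d2_le: "expectation (\<lambda>\<omega>. (c t \<omega>)\<^sup>2 * (\<xi> t \<omega>)\<^sup>2) \<le> v * expectation (\<lambda>\<omega>. (c t \<omega>)\<^sup>2)" for t
  proof -
    interpret G: finite_measure_subalgebra M "F t"
      by unfold_locales (rule subalg)
    have meas: "(\<lambda>\<omega>. (c t \<omega>)\<^sup>2) \<in> borel_measurable (F t)" "(\<lambda>\<omega>. (\<xi> t \<omega>)\<^sup>2) \<in> borel_measurable M"
      using c(1)[of t] \<xi>_M[of t] by measurable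
    note int = G.real_cond_exp_intg[OF d2_int meas]
    have "expectation (\<lambda>\<omega>. (c t \<omega>)\<^sup>2 * (\<xi> t \<omega>)\<^sup>2)
        = expectation (\<lambda>\<omega>. (c t \<omega>)\<^sup>2 * real_cond_exp M (F t) (\<lambda>\<omega>. (\<xi> t \<omega>)\<^sup>2) \<omega>)"
      using int(2) by simp
    also have "\<dots> \<le> expectation (\<lambda>\<omega>. (c t \<omega>)\<^sup>2 * v)"
    proof (rule integral_mono_AE)
      show "AE \<omega> in M. (c t \<omega>)\<^sup>2 * real_cond_exp M (F t) (\<lambda>\<omega>. (\<xi> t \<omega>)\<^sup>2) \<omega> \<le> (c t \<omega>)\<^sup>2 * v"
        using cond_variance[of t] by eventually_elim (intro mult_left_mono, auto)
    qed (use int(1) c2_int in auto)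
    finally show ?thesis by (simp add: mult.commute)
  qed
  define S where "S n \<omega> = (\<Sum>t<n. c t \<omega> * \<xi> t \<omega>)" for n \<omega>
  have S_F: "S n \<in> borel_measurable (F n)" for n
    unfolding S_def by (rule transform_measurable[OF c(1)])
  then have S_M: "S n \<in> borel_measurable M" for n
    by (rule measurable_F_imp_M)
  have expand: "(S (Suc n) \<omega>)\<^sup>2 =
      (S n \<omega>)\<^sup>2 + 2 * (S n \<omega> * c n \<omega> * \<xi> n \<omega>) + (c n \<omega>)\<^sup>2 * (\<xi> n \<omega>)\<^sup>2" for n \<omega>
    by (simp add: S_def power2_sum power_mult_distrib algebra_simps)
  have "integrable M (\<lambda>\<omega>. (S n \<omega>)\<^sup>2) \<and>
      expectation (\<lambda>\<omega>. (S n \<omega>)\<^sup>2) \<le> v * expectation (\<lambda>\<omega>. \<Sum>t<n. (c t \<omega>)\<^sup>2)" for n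
  proof (induction n)
    case 0
    show ?case by (simp add: S_def)
  next
    case (Suc n)
    interpret G: finite_measure_subalgebra M "F n"
      by unfold_locales (rule subalg)
    \<comment> \<open>Integrability of the product comes from that of the two squares; only then may
      the factor known at time \<open>n\<close> be pulled out of the conditional
      expectation.\<close>
    have cross_int: "integrable M (\<lambda>\<omega>. S n \<omega> * c n \<omega> * \<xi> n \<omega>)"
      using integrable_mult_of_squares[of "S n" "\<lambda>\<omega>. c n \<omega> * \<xi> n \<omega>"] S_M c_M \<xi>_M Suc d2_int
      by (simp add: power_mult_distrib mult.assoc)
    have "(\<lambda>\<omega>. S n \<omega> * c n \<omega>) \<in> borel_measurable (F n)"
      using S_F c(1) by simp
    from G.real_cond_exp_intg(2)[OF cross_int this \<xi>_M]
    have "expectation (\<lambda>\<omega>. S n \<omega> * c n \<omega> * \<xi> n \<omega>)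
        = expectation (\<lambda>\<omega>. S n \<omega> * c n \<omega> * real_cond_exp M (F n) (\<xi> n) \<omega>)" by simp
    also have "\<dots> = expectation (\<lambda>\<omega>. 0)"
      by (rule integral_cong_AE) (use S_M c_M cond_mean[of n] in auto)
    finally have cross: "expectation (\<lambda>\<omega>. S n \<omega> * c n \<omega> * \<xi> n \<omega>) = 0" by simp
    have "integrable M (\<lambda>\<omega>. (S (Suc n) \<omega>)\<^sup>2)"
      unfolding expand using Suc cross_int d2_int by auto
    moreover have "expectation (\<lambda>\<omega>. (S (Suc n) \<omega>)\<^sup>2) =
        expectation (\<lambda>\<omega>. (S n \<omega>)\<^sup>2) + expectation (\<lambda>\<omega>. (c n \<omega>)\<^sup>2 * (\<xi> n \<omega>)\<^sup>2)"
      unfolding expand using Suc cross_int d2_int cross by simp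
    moreover have "expectation (\<lambda>\<omega>. \<Sum>t<Suc n. (c t \<omega>)\<^sup>2) =
        expectation (\<lambda>\<omega>. \<Sum>t<n. (c t \<omega>)\<^sup>2) + expectation (\<lambda>\<omega>. (c n \<omega>)\<^sup>2)"
      using c2_int by (simp add: Bochner_Integration.integral_add)
    ultimately show ?case
      using Suc d2_le[of n] by (simp add: algebra_simps)
  qed
  then show "integrable M (\<lambda>\<omega>. (\<Sum>t<n. c t \<omega> * \<xi> t \<omega>)\<^sup>2)"
    "expectation (\<lambda>\<omega>. (\<Sum>t<n. c t \<omega> * \<xi> t \<omega>)\<^sup>2) \<le> v * expectation (\<lambda>\<omega>. \<Sum>t<n. (c t \<omega>)\<^sup>2)"
    by (simp_all add: S_def)
qed


text \<open>With the coefficient 1 and a single step, the second moment inequality bounds a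
  nonnegative number by \<open>v\<close>.\<close>

lemma variance_bound_nonneg: "0 \<le> v"
proof -
  have "0 \<le> expectation (\<lambda>\<omega>. (\<Sum>t<1. 1 * \<xi> t \<omega>)\<^sup>2)"
    by simp
  also have "\<dots> \<le> v * expectation (\<lambda>\<omega>. \<Sum>t<1::nat. 1\<^sup>2)"
    by (rule transform_second_moment(2)[where c = "\<lambda>_ _. 1" and C = 1 and n = 1]) auto
  finally show ?thesis by (simp add: prob_space)
qed

text \<open>Freezing the sum once it has exceeded the level \<open>e\<close> again gives a martingale transform, so that
  Markov's inequality for its last value already controls the maximum.\<close>

lemma maximal_inequality:
  assumes c: "\<And>t. c t \<in> borel_measurable (F t)" "\<And>t \<omega>. \<bar>c t \<omega>\<bar> \<le> C" and e: "e > 0"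
  shows "prob {\<omega> \<in> space M. \<exists>k\<le>n. e < \<bar>\<Sum>t<k. c t \<omega> * \<xi> t \<omega>\<bar>}
    \<le> v * expectation (\<lambda>\<omega>. \<Sum>t<n. (c t \<omega>)\<^sup>2) / e\<^sup>2"
proof -
  define S where "S n \<omega> = (\<Sum>t<n. c t \<omega> * \<xi> t \<omega>)" for n \<omega>
  define c' where "c' t \<omega> = (if \<forall>k\<le>t. \<bar>S k \<omega>\<bar> \<le> e then c t \<omega> else 0)" for t \<omega>
  define S' where "S' n \<omega> = (\<Sum>t<n. c' t \<omega> * \<xi> t \<omega>)" for n \<omega>
  have S_F: "S k \<in> borel_measurable (F t)" if "k \<le> t" for k t
    using measurable_F_mono[OF transform_measurable[OF c(1)] that] by (simp add: S_def[abs_def])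
  have c'_F: "c' t \<in> borel_measurable (F t)" for t
    unfolding c'_def using S_F c(1) by measurable
  have C: "0 \<le> C" using c(2) abs_ge_zero order_trans by blast
  have c'_bd: "\<bar>c' t \<omega>\<bar> \<le> C" for t \<omega>
    using c(2) C by (simp add: c'_def)
  have c_M: "c t \<in> borel_measurable M" and c'_M: "c' t \<in> borel_measurable M" for t
    using measurable_F_imp_M c(1) c'_F by blast+
  have c2: "(c t \<omega>)\<^sup>2 \<le> C\<^sup>2" "(c' t \<omega>)\<^sup>2 \<le> C\<^sup>2" for t \<omega>
    using power_mono[OF c(2)[of t \<omega>] abs_ge_zero, of 2] power_mono[OF c'_bd[of t \<omega>] abs_ge_zero, of 2]
    by simp_all
  have c2_int: "integrable M (\<lambda>\<omega>. (c t \<omega>)\<^sup>2)" "integrable M (\<lambda>\<omega>. (c' t \<omega>)\<^sup>2)" for t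
    using c_M[of t] c'_M[of t] c2 by (auto intro!: integrable_const_bound[of _ "C\<^sup>2"])
  have frozen: "e < \<bar>S' n \<omega>\<bar>" if "\<exists>k\<le>n. e < \<bar>S k \<omega>\<bar>" for \<omega>
  proof -
    define k where "k = (LEAST k. e < \<bar>S k \<omega>\<bar>)"
    have k: "e < \<bar>S k \<omega>\<bar>"
      unfolding k_def using that by (metis LeastI)
    have "k \<le> n"
      unfolding k_def using that by (meson Least_le order_trans)
    have before: "\<bar>S j \<omega>\<bar> \<le> e" if "j < k" for j
      using not_less_Least[of j "\<lambda>k. e < \<bar>S k \<omega>\<bar>"] that by (simp add: k_def)
    have "S' n \<omega> = (\<Sum>t<k. c t \<omega> * \<xi> t \<omega>)"
      unfolding S'_def
    proof (rule sum.mono_neutral_cong_right)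
      show "\<forall>t\<in>{..<n} - {..<k}. c' t \<omega> * \<xi> t \<omega> = 0"
        using k by (auto simp: c'_def not_less[symmetric])
      show "c' t \<omega> * \<xi> t \<omega> = c t \<omega> * \<xi> t \<omega>" if "t \<in> {..<k}" for t
        using before that by (auto simp: c'_def)
    qed (use \<open>k \<le> n\<close> in auto)
    with k show ?thesis by (simp add: S_def)
  qed
  have S'_M: "S' n \<in> borel_measurable M"
    unfolding S'_def[abs_def] by (rule measurable_F_imp_M[OF transform_measurable[OF c'_F]])
  have S'_int: "integrable M (\<lambda>\<omega>. (S' n \<omega>)\<^sup>2)"
    unfolding S'_def by (rule transform_second_moment(1)[OF c'_F c'_bd])
  have "prob {\<omega> \<in> space M. \<exists>k\<le>n. e < \<bar>S k \<omega>\<bar>} \<le> prob {\<omega> \<in> space M. e\<^sup>2 \<le> (S' n \<omega>)\<^sup>2}"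
  proof (rule finite_measure_mono)
    show "{\<omega> \<in> space M. \<exists>k\<le>n. e < \<bar>S k \<omega>\<bar>} \<subseteq> {\<omega> \<in> space M. e\<^sup>2 \<le> (S' n \<omega>)\<^sup>2}"
      using frozen e by (force simp: abs_le_square_iff[symmetric])
  qed (use S'_M in measurable)
  also have "\<dots> \<le> expectation (\<lambda>\<omega>. (S' n \<omega>)\<^sup>2) / e\<^sup>2"
    by (rule integral_Markov_inequality_measure[where A = "{}"]) (use S'_int e in auto)
  also have "expectation (\<lambda>\<omega>. (S' n \<omega>)\<^sup>2) \<le> v * expectation (\<lambda>\<omega>. \<Sum>t<n. (c' t \<omega>)\<^sup>2)"
    unfolding S'_def by (rule transform_second_moment(2)[OF c'_F c'_bd])
  also have "\<dots> \<le> v * expectation (\<lambda>\<omega>. \<Sum>t<n. (c t \<omega>)\<^sup>2)"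
    using c2_int variance_bound_nonneg
    by (intro mult_left_mono integral_mono Bochner_Integration.integrable_sum sum_mono)
      (auto simp: c'_def)
  finally show ?thesis
    using e by (simp add: S_def divide_right_mono)
qed

text \<open>The sure bound \<open>K\<close> makes the expected squares of the coefficients summable.
  Their tails control, through the maximal inequality, the oscillation of the sums after time
  \<open>m\<close>, so the sums are almost surely Cauchy.\<close>

lemma transform_convergent_of_bounded:
  assumes c: "\<And>t. c t \<in> borel_measurable (F t)" and K: "\<And>n \<omega>. (\<Sum>t<n. (c t \<omega>)\<^sup>2) \<le> K"
  shows "AE \<omega> in M. convergent (\<lambda>n. \<Sum>t<n. c t \<omega> * \<xi> t \<omega>)"
proof -
  define S where "S n \<omega> = (\<Sum>t<n. c t \<omega> * \<xi> t \<omega>)" for n \<omega>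
  have c_M: "c t \<in> borel_measurable M" for t
    using measurable_F_imp_M c(1) by blast
  have S_M [measurable]: "S k \<in> borel_measurable M" for k
    unfolding S_def[abs_def] by (rule measurable_F_imp_M[OF transform_measurable[OF c(1)]])
  have c2: "(c t \<omega>)\<^sup>2 \<le> K" for t \<omega>
    using K[of \<omega> "Suc t"] by (simp add: sum_nonneg order_trans[rotated])
  have c_bd: "\<bar>c t \<omega>\<bar> \<le> sqrt K" for t \<omega>
    using c2[of t \<omega>] by (simp add: real_le_rsqrt)
  have c2_int: "integrable M (\<lambda>\<omega>. (c t \<omega>)\<^sup>2)" for t
    by (rule integrable_const_bound[of _ K]) (use c_M c2 in auto)
  define q where "q t = expectation (\<lambda>\<omega>. (c t \<omega>)\<^sup>2)" for t
  have q_nonneg: "q t \<ge> 0" for t by (simp add: q_def)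
  have "(\<Sum>t<n. q t) \<le> K" for n
  proof -
    have "(\<Sum>t<n. q t) = expectation (\<lambda>\<omega>. \<Sum>t<n. (c t \<omega>)\<^sup>2)"
      using c2_int by (simp add: q_def)
    also have "\<dots> \<le> K"
      by (rule integral_le_const) (use c2_int K in auto)
    finally show ?thesis .
  qed
  then have q_sum: "summable q"
    using q_nonneg by (intro summableI_nonneg_bounded) auto
  have tail_bound: "prob {\<omega> \<in> space M. \<exists>k\<ge>m. e < \<bar>S k \<omega> - S m \<omega>\<bar>} \<le> v * (\<Sum>t. q (t + m)) / e\<^sup>2"
    if e: "e > 0" for e m
  proof -
    \<comment> \<open>Erasing the coefficients before \<open>m\<close> turns the partial sums into
      the increments \<open>S k - S m\<close>, to which the maximal inequality then applies.\<close>
    define c' where "c' t \<omega> = (if t < m then 0 else c t \<omega>)" for t \<omega>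
    define E where "E n = {\<omega> \<in> space M. \<exists>k\<le>n. e < \<bar>\<Sum>t<k. c' t \<omega> * \<xi> t \<omega>\<bar>}" for n
    have S': "(\<Sum>t<k. c' t \<omega> * \<xi> t \<omega>) = (if k \<le> m then 0 else S k \<omega> - S m \<omega>)" for k \<omega>
    proof (cases "k \<le> m")
      case False
      then have "(\<Sum>t<k. c' t \<omega> * \<xi> t \<omega>) = (\<Sum>t\<in>{..<k} - {..<m}. c t \<omega> * \<xi> t \<omega>)"
        by (intro sum.mono_neutral_cong_right) (auto simp: c'_def)
      also have "\<dots> = S k \<omega> - S m \<omega>"
        unfolding S_def using False by (intro sum_diff) auto
      finally show ?thesis using False by simp
    qed (simp add: c'_def)
    have E_sets: "E n \<in> events" for n
      unfolding E_def S' by measurable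
    have E_bound: "prob (E n) \<le> v * (\<Sum>t. q (t + m)) / e\<^sup>2" for n
    proof -
      have c'2_int: "integrable M (\<lambda>\<omega>. (c' t \<omega>)\<^sup>2)"
        and c'2_exp: "expectation (\<lambda>\<omega>. (c' t \<omega>)\<^sup>2) = (if t < m then 0 else q t)" for t
        using c2_int[of t] by (cases "t < m"; simp add: c'_def q_def)+
      have "prob (E n) \<le> v * expectation (\<lambda>\<omega>. \<Sum>t<n. (c' t \<omega>)\<^sup>2) / e\<^sup>2"
        unfolding E_def
      proof (rule maximal_inequality[OF _ _ e])
        show "c' t \<in> borel_measurable (F t)" for t
          unfolding c'_def using c(1) by measurable
        show "\<bar>c' t \<omega>\<bar> \<le> sqrt K" for t \<omega>
          using c_bd[of t \<omega>] K[of \<omega> 0] by (simp add: c'_def)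
      qed
      also have "expectation (\<lambda>\<omega>. \<Sum>t<n. (c' t \<omega>)\<^sup>2) = (\<Sum>t<n. if t < m then 0 else q t)"
        using c'2_int by (simp add: c'2_exp)
      also have "\<dots> = (\<Sum>t\<in>{m..<n}. q t)"
        by (intro sum.mono_neutral_cong_right) auto
      also have "\<dots> = (\<Sum>t<n - m. q (t + m))"
        using sum.shift_bounds_nat_ivl[of q 0 m "n - m"]
        by (cases "m \<le> n") (auto simp: atLeast0LessThan)
      also have "\<dots> \<le> (\<Sum>t. q (t + m))"
        using q_sum q_nonneg by (intro sum_le_suminf) (auto simp: summable_iff_shift)
      finally show ?thesis
        using variance_bound_nonneg by (simp add: divide_right_mono mult_left_mono)
    qed
    \<comment> \<open>The bound on \<open>prob (E n)\<close> does not depend on \<open>n\<close>, so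
      continuity from below extends it to an unbounded horizon.\<close>
    have "incseq E"
      unfolding incseq_def E_def using order_trans by blast
    then have "(\<lambda>n. prob (E n)) \<longlonglongrightarrow> prob (\<Union>n. E n)"
      using E_sets by (intro finite_Lim_measure_incseq) auto
    then have "prob (\<Union>n. E n) \<le> v * (\<Sum>t. q (t + m)) / e\<^sup>2"
      using E_bound by (intro LIMSEQ_le_const2) auto
    moreover have "(\<Union>n. E n) = {\<omega> \<in> space M. \<exists>k\<ge>m. e < \<bar>S k \<omega> - S m \<omega>\<bar>}"
    proof -
      have "(\<Union>n. E n) = {\<omega> \<in> space M. \<exists>k. e < \<bar>if k \<le> m then 0 else S k \<omega> - S m \<omega>\<bar>}"
        unfolding E_def S' by blast
      also have "\<dots> = {\<omega> \<in> space M. \<exists>k\<ge>m. e < \<bar>S k \<omega> - S m \<omega>\<bar>}"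
        using e by (intro Collect_cong conj_cong refl ex_cong1) (auto simp: not_le le_less)
      finally show ?thesis .
    qed
    ultimately show ?thesis by simp
  qed
  have Cauchy_e: "AE \<omega> in M. \<exists>m. \<forall>k\<ge>m. \<bar>S k \<omega> - S m \<omega>\<bar> \<le> e" if e: "e > 0" for e
  proof -
    define N where "N = {\<omega> \<in> space M. \<forall>m. \<exists>k\<ge>m. e < \<bar>S k \<omega> - S m \<omega>\<bar>}"
    have N: "N \<in> events" unfolding N_def by measurable
    have "prob N \<le> v * (\<Sum>t. q (t + m)) / e\<^sup>2" for m
    proof -
      have "prob N \<le> prob {\<omega> \<in> space M. \<exists>k\<ge>m. e < \<bar>S k \<omega> - S m \<omega>\<bar>}"
        by (rule finite_measure_mono) (auto simp: N_def)
      with tail_bound[OF e, of m] show ?thesis by simp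
    qed
    moreover have "(\<lambda>m. v * (\<Sum>t. q (t + m)) / e\<^sup>2) \<longlonglongrightarrow> v * 0 / e\<^sup>2"
      by (intro tendsto_intros suminf_exist_split2[OF q_sum]) (use e in auto)
    ultimately have "prob N \<le> v * 0 / e\<^sup>2"
      by (intro LIMSEQ_le_const) auto
    then have "AE \<omega> in M. \<omega> \<notin> N"
      using N by (subst prob_eq_0[symmetric]) (auto simp: measure_le_0_iff)
    then show ?thesis
      using AE_space by eventually_elim (auto simp: N_def not_less)
  qed
  \<comment> \<open>Countably many tolerances suffice for the Cauchy property and allow the
    exceptional null sets to be merged.\<close>
  have "AE \<omega> in M. \<forall>j::nat. \<exists>m. \<forall>k\<ge>m. \<bar>S k \<omega> - S m \<omega>\<bar> \<le> 1 / real (Suc j)"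
    by (subst AE_all_countable) (auto intro!: Cauchy_e)
  then show ?thesis
  proof eventually_elim
    case (elim \<omega>)
    have "Cauchy (\<lambda>n. S n \<omega>)"
    proof (rule metric_CauchyI)
      fix e :: real assume "e > 0"
      then obtain j where j: "1 / real (Suc j) < e / 2"
        using nat_approx_posE[of "e / 2"] by auto
      obtain m where m: "\<And>k. k \<ge> m \<Longrightarrow> \<bar>S k \<omega> - S m \<omega>\<bar> \<le> 1 / real (Suc j)"
        using elim by blast
      have "dist (S k \<omega>) (S l \<omega>) < e" if "k \<ge> m" "l \<ge> m" for k l
        using m[OF that(1)] m[OF that(2)] j unfolding dist_real_def by linarith
      then show "\<exists>M. \<forall>m\<ge>M. \<forall>n\<ge>M. dist (S m \<omega>) (S n \<omega>) < e" by blast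
    qed
    then show ?case
      by (simp add: S_def Cauchy_convergent)
  qed
qed

text \<open>Localization: cutting the coefficients off at level \<open>K\<close> of accumulated
  squares gives the sure bound of the previous lemma. Almost every trajectory has a finite total, so
  some \<open>K\<close> leaves all its coefficients unchanged.\<close>

theorem transform_convergent:
  assumes a: "\<And>t. a t \<in> borel_measurable (F t)"
    and summable: "AE \<omega> in M. summable (\<lambda>t. (a t \<omega>)\<^sup>2)"
  shows "AE \<omega> in M. convergent (\<lambda>n. \<Sum>t<n. a t \<omega> * \<xi> t \<omega>)"
proof -
  \<comment> \<open>The test sum includes the index \<open>t\<close> itself, so the level
    \<open>K\<close> is never overshot. This is still predictable, because \<open>a t\<close> is
    known at time \<open>t\<close>.\<close>
  define c where "c K t \<omega> = (if (\<Sum>s\<le>t. (a s \<omega>)\<^sup>2) \<le> real K then a t \<omega> else 0)" for K t \<omega>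
  have "AE \<omega> in M. \<forall>K. convergent (\<lambda>n. \<Sum>t<n. c K t \<omega> * \<xi> t \<omega>)"
  proof (subst AE_all_countable, rule allI, rule transform_convergent_of_bounded)
    fix K t
    have "a s \<in> borel_measurable (F t)" if "s \<le> t" for s
      using measurable_F_mono[OF a that] .
    then have "(\<lambda>\<omega>. \<Sum>s\<le>t. (a s \<omega>)\<^sup>2) \<in> borel_measurable (F t)"
      by (intro borel_measurable_sum borel_measurable_power) auto
    then show "c K t \<in> borel_measurable (F t)"
      unfolding c_def using a[of t] by measurable
  next
    fix K n \<omega>
    show "(\<Sum>t<n. (c K t \<omega>)\<^sup>2) \<le> real K"
    proof (induction n)
      case (Suc n)
      show ?case
      proof (cases "(\<Sum>s\<le>n. (a s \<omega>)\<^sup>2) \<le> real K")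
        case True
        have "(\<Sum>t<Suc n. (c K t \<omega>)\<^sup>2) \<le> (\<Sum>t<Suc n. (a t \<omega>)\<^sup>2)"
          by (intro sum_mono) (simp add: c_def)
        with True show ?thesis by (simp only: lessThan_Suc_atMost)
      next
        case False
        with Suc show ?thesis by (simp add: c_def)
      qed
    qed simp
  qed
  then show ?thesis
    using summable
  proof eventually_elim
    case (elim \<omega>)
    obtain K where "(\<Sum>t. (a t \<omega>)\<^sup>2) \<le> real K"
      using real_arch_simple by blast
    moreover have "(\<Sum>s\<le>t. (a s \<omega>)\<^sup>2) \<le> (\<Sum>t. (a t \<omega>)\<^sup>2)" for t
      using elim(2) by (intro sum_le_suminf) auto
    ultimately have "(\<Sum>s\<le>t. (a s \<omega>)\<^sup>2) \<le> real K" for t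
      using order_trans by blast
    then have "c K t \<omega> = a t \<omega>" for t
      by (simp add: c_def)
    with elim(1)[rule_format, of K] show ?case by simp
  qed
qed

end

section \<open>The noise of the Bellman operator\<close>

text \<open>The hypothesis \<open>law\<close> says that restricting \<open>M\<close> to
  \<open>E\<close> and pushing it forward along \<open>T\<close> gives \<open>prob E\<close> times
  \<open>D\<close>. Integrals then transfer through the image measure and the constant
  density.\<close>

lemma (in prob_space) conditional_law_integral:
  fixes h :: "'c \<Rightarrow> real"
  assumes T: "T \<in> M \<rightarrow>\<^sub>M N" and E: "E \<in> events"
    and D: "finite_measure D" "sets D = sets N"
    and law: "\<And>B. B \<in> sets N \<Longrightarrow> prob (E \<inter> {\<omega> \<in> space M. T \<omega> \<in> B}) = prob E * measure D B"
    and h: "integrable D h"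
  shows "integrable M (\<lambda>\<omega>. indicator E \<omega> * h (T \<omega>))"
    and "expectation (\<lambda>\<omega>. indicator E \<omega> * h (T \<omega>)) = prob E * (\<integral>z. h z \<partial>D)"
proof -
  interpret D: finite_measure D by fact
  let ?ME = "density M (\<lambda>\<omega>. ennreal (indicator E \<omega>))"
  have T': "T \<in> ?ME \<rightarrow>\<^sub>M N" using T by simp
  have h_N: "h \<in> borel_measurable N"
    using borel_measurable_integrable[OF h] measurable_cong_sets[OF D(2)] by blast
  have hT: "(\<lambda>\<omega>. h (T \<omega>)) \<in> borel_measurable M"
    using measurable_compose[OF T h_N] .
  have distr: "distr ?ME N T = density D (\<lambda>_. ennreal (prob E))"
  proof (rule measure_eqI)
    show "sets (distr ?ME N T) = sets (density D (\<lambda>_. ennreal (prob E)))"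
      using D(2) by simp
    fix B assume "B \<in> sets (distr ?ME N T)"
    then have B: "B \<in> sets N" "B \<in> sets D" using D(2) by auto
    have TB: "T -` B \<inter> space M \<in> events" using T B(1) by (rule measurable_sets)
    have "emeasure (distr ?ME N T) B = emeasure ?ME (T -` B \<inter> space M)"
      using emeasure_distr[OF T' B(1)] by simp
    also have "\<dots> = (\<integral>\<^sup>+ \<omega>. indicator (E \<inter> {\<omega> \<in> space M. T \<omega> \<in> B}) \<omega> \<partial>M)"
      using E TB by (subst emeasure_density) (auto intro!: nn_integral_cong simp: indicator_def)
    also have "\<dots> = emeasure M (E \<inter> {\<omega> \<in> space M. T \<omega> \<in> B})"
    proof (rule nn_integral_indicator)
      have "{\<omega> \<in> space M. T \<omega> \<in> B} = T -` B \<inter> space M" by auto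
      with E TB show "E \<inter> {\<omega> \<in> space M. T \<omega> \<in> B} \<in> events" by auto
    qed
    also have "\<dots> = ennreal (prob E * measure D B)"
      by (simp add: emeasure_eq_measure law[OF B(1)])
    also have "\<dots> = emeasure (density D (\<lambda>_. ennreal (prob E))) B"
      using B(2) by (simp add: emeasure_density_const D.emeasure_eq_measure ennreal_mult)
    finally show "emeasure (distr ?ME N T) B = emeasure (density D (\<lambda>_. ennreal (prob E))) B" .
  qed
  have "integrable (density D (\<lambda>_. ennreal (prob E))) h"
    using h by (subst integrable_density) auto
  then have "integrable ?ME (\<lambda>\<omega>. h (T \<omega>))"
    unfolding distr[symmetric] using integrable_distr_eq[OF T' h_N] by blast
  then show "integrable M (\<lambda>\<omega>. indicator E \<omega> * h (T \<omega>))"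
    using E hT by (subst (asm) integrable_density) auto
  have "expectation (\<lambda>\<omega>. indicator E \<omega> * h (T \<omega>)) = (\<integral>\<omega>. h (T \<omega>) \<partial>?ME)"
    using E hT by (subst integral_density) auto
  also have "\<dots> = (\<integral>z. h z \<partial>density D (\<lambda>_. ennreal (prob E)))"
    unfolding distr[symmetric] using integral_distr[OF T' h_N] by simp
  also have "\<dots> = prob E * (\<integral>z. h z \<partial>D)"
    using h by (subst integral_density) auto
  finally show "expectation (\<lambda>\<omega>. indicator E \<omega> * h (T \<omega>)) = prob E * (\<integral>z. h z \<partial>D)" .
qed

text \<open>Mean zero is the Bellman equation; by linearity only the marginals of \<open>D\<close>
  enter, so reward and next state may be dependent. The second moment is finite because
  \<open>f\<close> differs from the reward by a bounded term, the state space being finite.\<close>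

lemma bellman_error_moments:
  fixes p :: "'s::finite \<Rightarrow> 'a::finite \<Rightarrow> 's pmf" and D :: "(real \<times> 's) measure"
  assumes D: "prob_space D" "sets D = sets (borel \<Otimes>\<^sub>M count_space UNIV)"
    and D_next: "distr D (count_space UNIV) snd = measure_pmf (p x b)"
    and D_rew: "distr D borel fst = R x b"
    and rew_var: "integrable (R x b) (\<lambda>z. z\<^sup>2)"
    and Qstar: "bellman_optimal p R \<gamma> Qstar"
  defines "f \<equiv> \<lambda>z. fst z + \<gamma> * Max (range (Qstar (snd z))) - Qstar x b"
  shows "integrable D f" "(\<integral>z. f z \<partial>D) = 0" "integrable D (\<lambda>z. (f z)\<^sup>2)"
proof -
  interpret prob_space D by fact
  define V where "V s = Max (range (Qstar s))" for s
  have meas: "fst \<in> borel_measurable D" "snd \<in> D \<rightarrow>\<^sub>M count_space UNIV"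
    using measurable_cong_sets[OF D(2) refl] by auto
  have fst2: "integrable D (\<lambda>z. (fst z)\<^sup>2)"
    using rew_var meas(1) unfolding D_rew[symmetric] by (subst (asm) integrable_distr_eq) auto
  then have fst1: "integrable D fst"
    using meas(1) by (rule square_integrable_imp_integrable[rotated])
  have V_meas: "(\<lambda>z. V (snd z)) \<in> borel_measurable D"
    using measurable_compose[OF meas(2), of V borel] by simp
  have V_bound: "\<bar>V s\<bar> \<le> (\<Sum>s\<in>UNIV. \<bar>V s\<bar>)" for s
    by (rule member_le_sum) auto
  have V1: "integrable D (\<lambda>z. V (snd z))"
    by (rule integrable_const_bound[where B = "\<Sum>s\<in>UNIV. \<bar>V s\<bar>"]) (use V_bound V_meas in auto)
  have "f = (\<lambda>z. fst z + \<gamma> * V (snd z) - Qstar x b)"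
    by (simp add: f_def V_def)
  note f = this
  show f1: "integrable D f"
    unfolding f using fst1 V1 by simp
  have "(\<integral>z. fst z \<partial>D) = (\<integral>z. z \<partial>R x b)"
    unfolding D_rew[symmetric] using meas(1) by (simp add: integral_distr)
  moreover have "(\<integral>z. V (snd z) \<partial>D) = measure_pmf.expectation (p x b) V"
    unfolding D_next[symmetric] using meas(2) by (simp add: integral_distr)
  moreover have "Qstar x b = (\<integral>z. z \<partial>R x b) + \<gamma> * measure_pmf.expectation (p x b) V"
    using Qstar unfolding bellman_optimal_def V_def[abs_def] by blast
  ultimately show "(\<integral>z. f z \<partial>D) = 0"
    unfolding f using fst1 V1 by (simp add: prob_space)
  \<comment> \<open>This is a uniform bound for \<open>\<gamma> * V s - Qstar x b\<close>; the
    square of the sum is then dominated by twice the sum of the squares.\<close>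
  define k where "k = \<bar>\<gamma>\<bar> * (\<Sum>s\<in>UNIV. \<bar>V s\<bar>) + \<bar>Qstar x b\<bar>"
  show "integrable D (\<lambda>z. (f z)\<^sup>2)"
  proof (rule Bochner_Integration.integrable_bound)
    show "integrable D (\<lambda>z. 2 * (fst z)\<^sup>2 + 2 * k\<^sup>2)"
      using fst2 by simp
    have "(f z)\<^sup>2 \<le> 2 * (fst z)\<^sup>2 + 2 * k\<^sup>2" for z
    proof -
      define u where "u = \<gamma> * V (snd z) - Qstar x b"
      have "\<bar>\<gamma> * V (snd z)\<bar> \<le> \<bar>\<gamma>\<bar> * (\<Sum>s\<in>UNIV. \<bar>V s\<bar>)"
        unfolding abs_mult by (intro mult_left_mono V_bound) auto
      then have "\<bar>u\<bar> \<le> k"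
        unfolding u_def k_def by linarith
      then have "u\<^sup>2 \<le> k\<^sup>2"
        using power_mono[of "\<bar>u\<bar>" k 2] by simp
      moreover have "(fst z + u)\<^sup>2 \<le> 2 * (fst z)\<^sup>2 + 2 * u\<^sup>2"
        using sum_squares_bound[of "fst z" u] by (simp add: power2_sum)
      moreover have "f z = fst z + u"
        by (simp add: f u_def)
      ultimately show ?thesis by simp
    qed
    then show "AE z in D. norm ((f z)\<^sup>2) \<le> norm (2 * (fst z)\<^sup>2 + 2 * k\<^sup>2)"
      by simp
  qed (use borel_measurable_integrable[OF f1] in simp)
qed

section \<open>From the sampling model to almost sure convergence\<close>

theorem mainTheorem1:
  fixes M :: "'w measure"
    and F :: "nat \<Rightarrow> 'w measure"
    and p :: "'s::finite \<Rightarrow> 'a::finite \<Rightarrow> 's pmf"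
    and R :: "'s \<Rightarrow> 'a \<Rightarrow> real measure"
    and D :: "'s \<Rightarrow> 'a \<Rightarrow> (real \<times> 's) measure"
    and \<gamma> :: real
    and Qstar :: "'s \<Rightarrow> 'a \<Rightarrow> real"
    and g :: "real \<Rightarrow> real \<Rightarrow> real \<Rightarrow> real"
    and sel :: "('a \<Rightarrow> real) \<Rightarrow> 'a"
    and QA0 QB0 QC0 :: "'w \<Rightarrow> 's \<Rightarrow> 'a \<Rightarrow> real"
    and S :: "nat \<Rightarrow> 'w \<Rightarrow> 's"
    and A :: "nat \<Rightarrow> 'w \<Rightarrow> 'a"
    and Rw :: "nat \<Rightarrow> 'w \<Rightarrow> real"
    and \<alpha> :: "nat \<Rightarrow> 'w \<Rightarrow> 's \<Rightarrow> 'a \<Rightarrow> real"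
  assumes gamma: "0 \<le> \<gamma>" "\<gamma> < 1"
    \<comment> \<open>joint law of (reward, next state) for each pair; marginals are r(s,a) and p(.|s,a)\<close>
    and D_prob: "\<And>x b. prob_space (D x b)"
    and D_sets: "\<And>x b. sets (D x b) = sets (borel \<Otimes>\<^sub>M count_space UNIV)"
    and D_next: "\<And>x b. distr (D x b) (count_space UNIV) snd = measure_pmf (p x b)"
    and D_rew: "\<And>x b. distr (D x b) borel fst = R x b"
    and rew_var: "\<And>x b. integrable (R x b) (\<lambda>z. z\<^sup>2)"
    and Qstar: "bellman_optimal p R \<gamma> Qstar"
    and g_choice: "g = mean_two_smallest \<or> g = median3"
    and sel_argmax: "\<And>f. f (sel f) = Max (range f)"
    \<comment> \<open>probability space and history filtration\<close>
    and M: "prob_space M"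
    and F_sub: "\<And>t. subalgebra M (F t)"
    and F_mono: "\<And>t. sets (F t) \<subseteq> sets (F (Suc t))"
    and Q0_meas: "\<And>x b. (\<lambda>\<omega>. QA0 \<omega> x b) \<in> borel_measurable (F 0)"
                 "\<And>x b. (\<lambda>\<omega>. QB0 \<omega> x b) \<in> borel_measurable (F 0)"
                 "\<And>x b. (\<lambda>\<omega>. QC0 \<omega> x b) \<in> borel_measurable (F 0)"
    and S_meas: "\<And>t. S t \<in> F t \<rightarrow>\<^sub>M count_space UNIV"
    and A_meas: "\<And>t. A t \<in> F t \<rightarrow>\<^sub>M count_space UNIV"
    and R_meas: "\<And>t. Rw t \<in> borel_measurable (F (Suc t))"
    and alpha_meas: "\<And>t x b. (\<lambda>\<omega>. \<alpha> t \<omega> x b) \<in> borel_measurable (F t)"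
    \<comment> \<open>(r_t, s_{t+1}) is drawn from D(s_t,a_t) conditionally on the history F t\<close>
    and sampling: "\<And>t E B. E \<in> sets (F t) \<Longrightarrow> B \<in> sets (borel \<Otimes>\<^sub>M count_space UNIV) \<Longrightarrow>
         measure M (E \<inter> {\<omega> \<in> space M. (Rw t \<omega>, S (Suc t) \<omega>) \<in> B})
         = (\<integral>\<omega>\<in>E. measure (D (S t \<omega>) (A t \<omega>)) B \<partial>M)"
    \<comment> \<open>(1) every state-action pair is visited infinitely often (a.s.)\<close>
    and visits: "AE \<omega> in M. \<forall>x b. infinite {t. S t \<omega> = x \<and> A t \<omega> = b}"
    \<comment> \<open>(2) learning rate conditions (a.s.)\<close>
    and alpha_cond: "AE \<omega> in M. \<forall>x b.
         (\<forall>t. 0 \<le> \<alpha> t \<omega> x b \<and> \<alpha> t \<omega> x b \<le> 1)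
       \<and> (\<forall>t. (x, b) \<noteq> (S t \<omega>, A t \<omega>) \<longrightarrow> \<alpha> t \<omega> x b = 0)
       \<and> filterlim (\<lambda>n. \<Sum>t<n. \<alpha> t \<omega> x b) at_top sequentially
       \<and> summable (\<lambda>t. (\<alpha> t \<omega> x b)\<^sup>2)"
  shows "AE \<omega> in M. \<forall>x b.
     (\<lambda>t. fst (ctq g \<gamma> sel (QA0 \<omega>, QB0 \<omega>, QC0 \<omega>) (\<lambda>t. S t \<omega>) (\<lambda>t. A t \<omega>) (\<lambda>t. Rw t \<omega>) (\<lambda>t. \<alpha> t \<omega>) t) x b)
        \<longlonglongrightarrow> Qstar x b
   \<and> (\<lambda>t. fst (snd (ctq g \<gamma> sel (QA0 \<omega>, QB0 \<omega>, QC0 \<omega>) (\<lambda>t. S t \<omega>) (\<lambda>t. A t \<omega>) (\<lambda>t. Rw t \<omega>) (\<lambda>t. \<alpha> t \<omega>) t)) x b)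
        \<longlonglongrightarrow> Qstar x b
   \<and> (\<lambda>t. snd (snd (ctq g \<gamma> sel (QA0 \<omega>, QB0 \<omega>, QC0 \<omega>) (\<lambda>t. S t \<omega>) (\<lambda>t. A t \<omega>) (\<lambda>t. Rw t \<omega>) (\<lambda>t. \<alpha> t \<omega>) t)) x b)
        \<longlonglongrightarrow> Qstar x b"
proof -
  interpret prob_space M by fact
  define T where "T t \<omega> = (Rw t \<omega>, S (Suc t) \<omega>)" for t \<omega>
  define f where "f x b z = fst z + \<gamma> * Max (range (Qstar (snd z))) - Qstar x b" for x b and z :: "real \<times> 's"
  \<comment> \<open>There is one noise sequence for each fixed pair, set to 0 when another pair is
    visited. On its support the sampling law is thus the fixed \<open>D x b\<close>.\<close>
  define \<xi> where "\<xi> x b t \<omega> = (if S t \<omega> = x \<and> A t \<omega> = b then f x b (T t \<omega>) else 0)" for x b t \<omega>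
  define v where "v x b = (\<integral>z. (f x b z)\<^sup>2 \<partial>D x b)" for x b
  have f_moments: "integrable (D x b) (f x b)" "(\<integral>z. f x b z \<partial>D x b) = 0"
    "integrable (D x b) (\<lambda>z. (f x b z)\<^sup>2)" for x b
    using bellman_error_moments[OF D_prob D_sets D_next D_rew rew_var Qstar]
    by (simp_all add: f_def[abs_def])
  have v_nonneg: "0 \<le> v x b" for x b by (simp add: v_def)
  have to_M: "h \<in> F t \<rightarrow>\<^sub>M N \<Longrightarrow> h \<in> M \<rightarrow>\<^sub>M N" for h t N
    using measurable_from_subalg[OF F_sub] .
  have T_F: "T t \<in> F (Suc t) \<rightarrow>\<^sub>M borel \<Otimes>\<^sub>M count_space UNIV" for t
    unfolding T_def[abs_def] using R_meas S_meas by (rule measurable_Pair)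
  define G where "G x b t = {\<omega> \<in> space M. S t \<omega> = x \<and> A t \<omega> = b}" for x b t
  have space_F: "space (F t) = space M" for t
    using F_sub by (simp add: subalgebra_def)
  have G_F: "G x b t \<in> sets (F t)" for x b t
  proof -
    have "S t -` {x} \<inter> space (F t) \<in> sets (F t)" "A t -` {b} \<inter> space (F t) \<in> sets (F t)"
      by (rule measurable_sets[OF S_meas], simp, rule measurable_sets[OF A_meas], simp)
    then have "(S t -` {x} \<inter> space (F t)) \<inter> (A t -` {b} \<inter> space (F t)) \<in> sets (F t)"
      by (rule sets.Int)
    also have "(S t -` {x} \<inter> space (F t)) \<inter> (A t -` {b} \<inter> space (F t)) = G x b t"
      by (auto simp: G_def space_F)
    finally show ?thesis .
  qed
  \<comment> \<open>On \<open>G x b t\<close> the random kernel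
    \<open>D (S t \<omega>) (A t \<omega>)\<close> is constantly \<open>D x b\<close>, so
    \<open>sampling\<close> takes the product form that \<open>conditional_law_integral\<close>
    requires.\<close>
  have law: "integrable M (\<lambda>\<omega>. indicator (E \<inter> G x b t) \<omega> * h (T t \<omega>))"
    "expectation (\<lambda>\<omega>. indicator (E \<inter> G x b t) \<omega> * h (T t \<omega>)) = prob (E \<inter> G x b t) * (\<integral>z. h z \<partial>D x b)"
    if E: "E \<in> sets (F t)" and h: "integrable (D x b) h" for E x b t and h :: "real \<times> 's \<Rightarrow> real"
  proof -
    have EG: "E \<inter> G x b t \<in> sets (F t)" using E G_F by auto
    then have EG_M: "E \<inter> G x b t \<in> events" using F_sub by (auto simp: subalgebra_def)
    have *: "prob ((E \<inter> G x b t) \<inter> {\<omega> \<in> space M. T t \<omega> \<in> B}) = prob (E \<inter> G x b t) * measure (D x b) B"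
      if B: "B \<in> sets (borel \<Otimes>\<^sub>M count_space UNIV)" for B
    proof -
      have "prob ((E \<inter> G x b t) \<inter> {\<omega> \<in> space M. T t \<omega> \<in> B})
          = (\<integral>\<omega>\<in>E \<inter> G x b t. measure (D (S t \<omega>) (A t \<omega>)) B \<partial>M)"
        unfolding T_def using EG B by (rule sampling)
      also have "\<dots> = (\<integral>\<omega>\<in>E \<inter> G x b t. measure (D x b) B \<partial>M)"
        using EG_M by (intro set_lebesgue_integral_cong) (auto simp: G_def)
      also have "\<dots> = prob (E \<inter> G x b t) * measure (D x b) B"
        using EG_M by (simp add: set_lebesgue_integral_def)
      finally show ?thesis .
    qed
    note integrals = conditional_law_integral[OF to_M[OF T_F] EG_M _ D_sets * h]
    show "integrable M (\<lambda>\<omega>. indicator (E \<inter> G x b t) \<omega> * h (T t \<omega>))"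
      "expectation (\<lambda>\<omega>. indicator (E \<inter> G x b t) \<omega> * h (T t \<omega>)) = prob (E \<inter> G x b t) * (\<integral>z. h z \<partial>D x b)"
      using integrals prob_space.finite_measure[OF D_prob] by blast+
  qed
  have noise: "AE \<omega> in M. convergent (\<lambda>n. \<Sum>t<n. \<alpha> t \<omega> x b * \<xi> x b t \<omega>)" for x b
  proof -
    have \<xi>_indicator: "indicator E \<omega> * \<xi> x b t \<omega> = indicator (E \<inter> G x b t) \<omega> * f x b (T t \<omega>)"
      "indicator E \<omega> * (\<xi> x b t \<omega>)\<^sup>2 = indicator (E \<inter> G x b t) \<omega> * (f x b (T t \<omega>))\<^sup>2"
      if "\<omega> \<in> space M" for E t \<omega>
      using that by (auto simp: \<xi>_def G_def indicator_def)
    \<comment> \<open>Set integrals over the events of \<open>F t\<close> characterize conditional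
      expectations. These values identify the conditional mean as 0 and the conditional second
      moment as \<open>v x b\<close> on \<open>G x b t\<close> and 0 elsewhere.\<close>
    have set_int: "set_integrable M E (\<xi> x b t)" "(\<integral>\<omega>\<in>E. \<xi> x b t \<omega> \<partial>M) = 0"
      "set_integrable M E (\<lambda>\<omega>. (\<xi> x b t \<omega>)\<^sup>2)"
      "(\<integral>\<omega>\<in>E. (\<xi> x b t \<omega>)\<^sup>2 \<partial>M) = prob (E \<inter> G x b t) * v x b"
      if E: "E \<in> sets (F t)" for E t
      using law[OF E f_moments(1), of x b] law[OF E f_moments(3), of x b] f_moments(2)[of x b]
      by (simp_all add: set_integrable_def set_lebesgue_integral_def \<xi>_indicator v_def
          cong: Bochner_Integration.integrable_cong Bochner_Integration.integral_cong)
    have int: "integrable M (\<xi> x b t)" "integrable M (\<lambda>\<omega>. (\<xi> x b t \<omega>)\<^sup>2)" for t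
      using set_int(1,3)[OF sets.top[of "F t"]] by (simp_all add: space_F set_integrable_def cong: Bochner_Integration.integrable_cong)
    have "square_integrable_martingale_differences M F (\<xi> x b) (v x b)"
    proof (unfold_locales)
      fix t
      show "subalgebra M (F t)" "sets (F t) \<subseteq> sets (F (Suc t))" by fact+
      show "integrable M (\<lambda>\<omega>. (\<xi> x b t \<omega>)\<^sup>2)" by (rule int)
      have F_subalg: "subalgebra (F (Suc t)) (F t)"
        using F_mono by (simp add: subalgebra_def space_F)
      have "f x b \<in> borel_measurable (D x b)"
        using f_moments(1) by (rule borel_measurable_integrable)
      then have "f x b \<in> borel_measurable (borel \<Otimes>\<^sub>M count_space UNIV)"
        using measurable_cong_sets[OF D_sets refl] by blast
      then have fT: "(\<lambda>\<omega>. f x b (T t \<omega>)) \<in> borel_measurable (F (Suc t))"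
        using measurable_compose[OF T_F] by blast
      have "S t \<in> F (Suc t) \<rightarrow>\<^sub>M count_space UNIV" "A t \<in> F (Suc t) \<rightarrow>\<^sub>M count_space UNIV"
        using measurable_from_subalg[OF F_subalg] S_meas A_meas by blast+
      with fT show "\<xi> x b t \<in> borel_measurable (F (Suc t))"
        unfolding \<xi>_def[abs_def] by measurable
      interpret H: finite_measure_subalgebra M "F t"
        by unfold_locales (rule F_sub)
      show "AE \<omega> in M. real_cond_exp M (F t) (\<xi> x b t) \<omega> = 0"
        by (rule H.real_cond_exp_charact) (use set_int(2) int(1) in \<open>auto simp: set_lebesgue_integral_def\<close>)
      have "AE \<omega> in M. real_cond_exp M (F t) (\<lambda>\<omega>. (\<xi> x b t \<omega>)\<^sup>2) \<omega> = indicator (G x b t) \<omega> * v x b"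
      proof (rule H.real_cond_exp_charact)
        have G_M: "G x b t \<in> events" using G_F F_sub unfolding subalgebra_def by blast
        then show "integrable M (\<lambda>\<omega>. indicator (G x b t) \<omega> * v x b)"
          by (intro Bochner_Integration.integrable_mult_left integrable_real_indicator) (auto simp: less_top[symmetric])
        show "(\<lambda>\<omega>. indicator (G x b t) \<omega> * v x b) \<in> borel_measurable (F t)"
          using G_F by simp
        fix E assume E: "E \<in> sets (F t)"
        then have "E \<in> events" using F_sub by (auto simp: subalgebra_def)
        have "(\<integral>\<omega>\<in>E. indicator (G x b t) \<omega> * v x b \<partial>M) = expectation (\<lambda>\<omega>. indicator (E \<inter> G x b t) \<omega> * v x b)"
          by (simp only: set_lebesgue_integral_def indicator_inter_arith real_scaleR_def mult.assoc)
        also have "\<dots> = prob (E \<inter> G x b t) * v x b"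
          using \<open>E \<in> events\<close> G_M by simp
        finally show "(\<integral>\<omega>\<in>E. (\<xi> x b t \<omega>)\<^sup>2 \<partial>M) = (\<integral>\<omega>\<in>E. indicator (G x b t) \<omega> * v x b \<partial>M)"
          unfolding set_int(4)[OF E] by (rule sym)
      qed (rule int(2))
      then show "AE \<omega> in M. real_cond_exp M (F t) (\<lambda>\<omega>. (\<xi> x b t \<omega>)\<^sup>2) \<omega> \<le> v x b"
        by eventually_elim (use v_nonneg in \<open>auto simp: indicator_def\<close>)
    qed
    then show ?thesis
      by (rule square_integrable_martingale_differences.transform_convergent)
        (use alpha_meas alpha_cond in auto)
  qed
  then have noise_all: "AE \<omega> in M. \<forall>x b. convergent (\<lambda>n. \<Sum>t<n. \<alpha> t \<omega> x b * \<xi> x b t \<omega>)"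
    by (simp add: AE_all_countable)
  have g: "\<bar>g x y z - x\<bar> \<le> e" if "\<bar>y - x\<bar> \<le> e" "\<bar>z - x\<bar> \<le> e" for x y z e
    using g_choice median3_bound[OF that] mean_two_smallest_bound[OF that] by auto
  \<comment> \<open>Both almost sure properties are now fixed on one trajectory, and the
    deterministic lemma finishes the argument there.\<close>
  from noise_all alpha_cond show ?thesis
  proof eventually_elim
    case (elim \<omega>)
    note conv = elim(1)[unfolded \<xi>_def f_def T_def fst_conv snd_conv, rule_format]
    show ?case
      by (intro allI conjI ctq_tendsto[where Qstar = Qstar] gamma g sel_argmax conv)
        (use elim(2) in auto)
  qed
qed

end
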